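(* Let $D_4$ be the polyomino consisting of the unit squares $[x,x+1]\times[0,1]$ for $x\in\{0,1,3,4,6,7,9,10\}$. (i) No torus $(\mathbf{Z}/p\mathbf{Z})\times(\mathbf{Z}/q\mathbf{Z})$ (with $p,q$ positive integers) can be tiled by copies of $D_4$ (translations and rotations by multiples of $90$ degrees allowed, no overlaps). (ii) There exists a signed tiling of the $24\times 12$ torus $(\mathbf{Z}/24\mathbf{Z})\times(\mathbf{Z}/12\mathbf{Z})$ by copies of $D_4$.
   Context: A polyomino is identified with the indicator function of a finite set of unit grid squares; on a torus $(\mathbf{Z}/p\mathbf{Z})\times(\mathbf{Z}/q\mathbf{Z})$ a copy of $D_4$ is the image (reduced modulo $(p,q)$) of an integer translate of $D_4$ or of its rotation by a multiple of $90$ degrees. A signed tiling of the torus by $D_4$ is a finite family of such copies $c_1,\dots,c_k$ together with signs $\epsilon_1,\dots,\epsilon_k\in\{+1,-1\}$ such that $\sum_i \epsilon_i\,\mathbf{1}_{c_i}$ equals the constant function $1$ on the torus (overlaps allowed). *)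

theory Defs
  imports Complex_Main "HOL-Library.Disjoint_Sets" "HOL-Library.Indicator_Function"
begin

(* The pair (i, j) stands for the unit square [i, i+1] x [j, j+1]. *)
type_synonym cell = "int \<times> int"

definition D4 :: "cell set" where
  "D4 = {(x, 0) | x. x \<in> {0, 1, 3, 4, 6, 7, 9, 10}}"

definition translate :: "int \<times> int \<Rightarrow> cell set \<Rightarrow> cell set" where
  "translate v P = (\<lambda>(i, j). (i + fst v, j + snd v)) ` P"

(* Counterclockwise rotation of the plane by 90 degrees about the origin sends the square
   [i, i+1] x [j, j+1] to [-j-1, -j] x [i, i+1]. *)
definition rotate90 :: "cell set \<Rightarrow> cell set" where
  "rotate90 P = (\<lambda>(i, j). (- j - 1, i)) ` P"

definition plane_copies :: "cell set \<Rightarrow> cell set set" where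
  "plane_copies P = {translate v ((rotate90 ^^ k) P) | v k. True}"

(* The torus (Z/pZ) x (Z/qZ), each residue class being represented by its least nonnegative
   element. *)
definition torus :: "nat \<Rightarrow> nat \<Rightarrow> cell set" where
  "torus p q = {0..<int p} \<times> {0..<int q}"

definition reduce :: "nat \<Rightarrow> nat \<Rightarrow> cell \<Rightarrow> cell" where
  "reduce p q = (\<lambda>(i, j). (i mod int p, j mod int q))"

(* Injectivity says that the copy does not overlap itself once it is wrapped around the torus,
   so that its image is again described by a 0/1-valued indicator function.  Without this
   condition every nonempty polyomino would tile the 1 x 1 torus. *)
definition torus_copies :: "nat \<Rightarrow> nat \<Rightarrow> cell set \<Rightarrow> cell set set" where
  "torus_copies p q P = {reduce p q ` c | c. c \<in> plane_copies P \<and> inj_on (reduce p q) c}"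

definition torus_tiling :: "nat \<Rightarrow> nat \<Rightarrow> cell set \<Rightarrow> cell set set \<Rightarrow> bool" where
  "torus_tiling p q P C \<longleftrightarrow>
     C \<subseteq> torus_copies p q P \<and> disjoint C \<and> \<Union> C = torus p q"

(* The list collects the pairs (sign, copy); a copy may occur in it several times. *)
definition signed_torus_tiling ::
    "nat \<Rightarrow> nat \<Rightarrow> cell set \<Rightarrow> (int \<times> cell set) list \<Rightarrow> bool" where
  "signed_torus_tiling p q P cs \<longleftrightarrow>
     (\<forall>(e, c) \<in> set cs. e \<in> {1, -1} \<and> c \<in> torus_copies p q P) \<and>
     (\<forall>t \<in> torus p q. (\<Sum>(e, c) \<leftarrow> cs. e * indicator c t) = 1)"

end

theory Submission
  imports Defs
begin

text \<open>
  Part (i): cut every copy into its four dominoes.  This gives a domino tiling of the plane in which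
  every horizontal (vertical) domino lies in a run of at least four dominoes of the same row
  (column) at distance 3 from each other.  No such domino tiling exists: a gap between two
  consecutive dominoes of a horizontal run is filled by a vertical domino, which we may assume to
  point upwards, and this leads to a contradiction inside a small box around the gap.

  Part (ii): a vertical copy covers, in its column of height 12, exactly the two residue classes of
  rows \<open>s\<close> and \<open>s + 1\<close> modulo 3.  Signed sums of such copies can add any multiple of 2 to one class
  of a column.  So it suffices to cover each cell of the class 0 an odd number of times by
  horizontal copies, which amounts to solving \<open>a(x) f(x) = 1 + x + \<dots> + x^23\<close> modulo 2 and
  \<open>x^24 - 1\<close> for \<open>f(x) = (1 + x)(1 + x^3)(1 + x^6)\<close>.
\<close>

section \<open>Copies of \<open>D4\<close> as bars\<close>

definition offsets :: "int set" where
  "offsets = {0, 1, 3, 4, 6, 7, 9, 10}"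

text \<open>\<open>offsets\<close> is symmetric under \<open>d\<close> to \<open>10 - d\<close>, so
  a half turn amounts to a translation and two orientations suffice.\<close>

definition bar :: "bool \<Rightarrow> int \<Rightarrow> int \<Rightarrow> int \<Rightarrow> cell" where
  "bar vertical a b d = (if vertical then (a, b + d) else (a + d, b))"

lemma offsets_alt: "offsets = {d. 0 \<le> d \<and> d \<le> 10 \<and> d mod 3 \<noteq> 2}"
proof (intro equalityI subsetI)
  fix d assume "d \<in> {d. 0 \<le> d \<and> d \<le> 10 \<and> d mod 3 \<noteq> (2::int)}"
  then have "d \<in> set [0..10]" "d mod 3 \<noteq> 2" by auto
  then show "d \<in> offsets" unfolding offsets_def by (auto simp: upto_rec1)
qed (auto simp: offsets_def)

lemma offsets_rev: "(\<lambda>d. 10 - d) ` offsets = offsets"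
  by (auto simp: offsets_def)

lemma translate_bar: "translate (s, t) (bar w a b ` offsets) = bar w (a + s) (b + t) ` offsets"
  unfolding translate_def image_image by (rule image_cong) (auto simp: bar_def)

text \<open>A quarter turn reverses a vertical bar: its top cell, at offset 10, becomes the leftmost
  one. The remaining 1 of the 11 comes from \<open>rotate90\<close>.\<close>

lemma rotate90_bar:
  "rotate90 (bar w a b ` offsets) =
    bar (\<not> w) (- b - (if w then 11 else 1)) a ` offsets"
proof (cases w)
  case True
  have "rotate90 (bar w a b ` offsets) = (\<lambda>d. bar False (- b - 11) a (10 - d)) ` offsets"
    unfolding rotate90_def image_image by (rule image_cong) (auto simp: True bar_def)
  also have "\<dots> = bar False (- b - 11) a ` offsets"
    using arg_cong[OF offsets_rev, of "image (bar False (- b - 11) a)"] unfolding image_image .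
  finally show ?thesis by (simp add: True)
qed (auto simp: rotate90_def image_image bar_def)

lemma D4_bar: "D4 = bar False 0 0 ` offsets"
  by (auto simp: D4_def offsets_def bar_def)

lemma funpow_rotate90_D4: "\<exists>w a b. (rotate90 ^^ k) D4 = bar w a b ` offsets"
proof (induction k)
  case 0
  have "(rotate90 ^^ 0) D4 = bar False 0 0 ` offsets" by (simp add: D4_bar)
  then show ?case by (intro exI)
next
  case (Suc k)
  then obtain w a b where "(rotate90 ^^ k) D4 = bar w a b ` offsets" by (elim exE)
  then have "(rotate90 ^^ Suc k) D4 = bar (\<not> w) (- b - (if w then 11 else 1)) a ` offsets"
    by (simp add: rotate90_bar)
  then show ?case by (intro exI)
qed

lemma plane_copies_D4: "P \<in> plane_copies D4 \<longleftrightarrow> (\<exists>w a b. P = bar w a b ` offsets)"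
proof
  assume "P \<in> plane_copies D4"
  then have "\<exists>v k. P = translate v ((rotate90 ^^ k) D4)"
    by (simp add: plane_copies_def)
  then obtain s t k where P: "P = translate (s, t) ((rotate90 ^^ k) D4)"
    by (metis surj_pair)
  obtain w a b where "(rotate90 ^^ k) D4 = bar w a b ` offsets"
    using funpow_rotate90_D4[of k] by (elim exE)
  then have "P = bar w (a + s) (b + t) ` offsets"
    using P translate_bar by simp
  then show "\<exists>w a b. P = bar w a b ` offsets" by (intro exI)
next
  assume "\<exists>w a b. P = bar w a b ` offsets"
  then obtain w a b where P: "P = bar w a b ` offsets" by (elim exE)
  \<comment> \<open>The rotated \<open>D4\<close> lies in column -1, hence
    \<open>a + 1\<close>.\<close>
  have "P = translate (if w then (a + 1, b) else (a, b)) ((rotate90 ^^ (if w then 1 else 0)) D4)"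
    by (simp add: P D4_bar rotate90_bar translate_bar)
  then show "P \<in> plane_copies D4"
    unfolding plane_copies_def mem_Collect_eq by (intro exI conjI TrueI)
qed

lemma torus_copies_D4:
  "c \<in> torus_copies p q D4 \<longleftrightarrow>
    (\<exists>w a b. c = reduce p q ` bar w a b ` offsets \<and> inj_on (\<lambda>d. reduce p q (bar w a b d)) offsets)"
proof -
  have "inj_on (bar w a b) offsets" for w a b
    by (auto simp: inj_on_def bar_def)
  then have "inj_on (reduce p q) (bar w a b ` offsets) \<longleftrightarrow> inj_on (\<lambda>d. reduce p q (bar w a b d)) offsets"
    for w a b
    by (simp add: comp_inj_on_iff comp_def)
  moreover have "c \<in> torus_copies p q D4 \<longleftrightarrow>
      (\<exists>w a b. c = reduce p q ` bar w a b ` offsets \<and> inj_on (reduce p q) (bar w a b ` offsets))"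
    unfolding torus_copies_def mem_Collect_eq plane_copies_D4 by metis
  ultimately show ?thesis by simp
qed

section \<open>Domino tilings of the plane with runs of length at least four\<close>

text \<open>\<open>h x y\<close> stands for a horizontal domino on the cells \<open>(x, y)\<close> and \<open>(x + 1, y)\<close>, and
  \<open>v x y\<close> for a vertical one on \<open>(x, y)\<close> and \<open>(x, y + 1)\<close>.\<close>

locale bar_tiling =
  fixes h v :: "int \<Rightarrow> int \<Rightarrow> bool"
  assumes cover: "h x y \<or> h (x - 1) y \<or> v x y \<or> v x (y - 1)"
    and disjoint:
      "\<not> h x y \<or> \<not> h (x - 1) y" "\<not> v x y \<or> \<not> v x (y - 1)"
      "\<not> h x y \<or> \<not> v x y" "\<not> h x y \<or> \<not> v x (y - 1)"
      "\<not> h (x - 1) y \<or> \<not> v x y" "\<not> h (x - 1) y \<or> \<not> v x (y - 1)"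
    and h_run: "h x y \<Longrightarrow> h (x - 3) y \<or> h (x + 3) y \<and> h (x + 6) y \<and> h (x + 9) y"
    and v_run: "v x y \<Longrightarrow> v x (y - 3) \<or> v x (y + 3) \<and> v x (y + 6) \<and> v x (y + 9)"
begin

text \<open>If \<open>h (x + 3) y\<close> fails, so does the second alternative of
  \<open>h_run\<close> at \<open>x\<close>, \<open>x - 3\<close> and \<open>x - 6\<close>, as each
  of them contains it.\<close>

lemma h_run': "h x y \<Longrightarrow> h (x + 3) y \<or> h (x - 3) y \<and> h (x - 6) y \<and> h (x - 9) y"
  using h_run[of x y] h_run[of "x - 3" y] h_run[of "x - 6" y] by (auto simp: add.commute)

lemma v_run': "v x y \<Longrightarrow> v x (y + 3) \<or> v x (y - 3) \<and> v x (y - 6) \<and> v x (y - 9)"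
  using v_run[of x y] v_run[of x "y - 3"] v_run[of x "y - 6"] by (auto simp: add.commute)

lemma translated: "bar_tiling (\<lambda>x y. h (x + s) (y + t)) (\<lambda>x y. v (x + s) (y + t))"
proof unfold_locales
  fix x y
  show "h (x + s) (y + t) \<or> h (x - 1 + s) (y + t) \<or> v (x + s) (y + t) \<or> v (x + s) (y - 1 + t)"
    using cover[of "x + s" "y + t"] by (simp add: algebra_simps)
qed (use disjoint[of "_ + s" "_ + t"] h_run[of "_ + s" "_ + t"] v_run[of "_ + s" "_ + t"]
     in \<open>simp_all add: algebra_simps\<close>)

text \<open>Row \<open>y\<close> goes to row \<open>- y\<close>, so rows \<open>y\<close> and
  \<open>y + 1\<close> come from \<open>- y\<close> and \<open>- y - 1\<close>, the latter being the
  lower one. Vertical runs are reversed, which is why \<open>v_run'\<close> is needed.\<close>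

lemma reflected: "bar_tiling (\<lambda>x y. h x (- y)) (\<lambda>x y. v x (- y - 1))"
proof unfold_locales
  fix x y
  show "v x (- y - 1) \<Longrightarrow> v x (- (y - 3) - 1) \<or>
      v x (- (y + 3) - 1) \<and> v x (- (y + 6) - 1) \<and> v x (- (y + 9) - 1)"
    using v_run'[of x "- y - 1"] by (simp add: algebra_simps)
  show "h x (- y) \<or> h (x - 1) (- y) \<or> v x (- y - 1) \<or> v x (- (y - 1) - 1)"
    using cover[of x "- y"] by auto
qed (use disjoint[of _ "- _"] h_run[of _ "- _"] in auto)

lemma transposed: "bar_tiling (\<lambda>x y. v y x) (\<lambda>x y. h y x)"
proof unfold_locales
  fix x y
  show "v y x \<or> v y (x - 1) \<or> h y x \<or> h (y - 1) x"
    using cover[of y x] by blast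
qed (use disjoint h_run v_run in blast)+

text \<open>Numerals for the position make all instances ground, as \<open>sat\<close> requires; a
  translation brings any other gap here.\<close>

lemma no_upward_gap_at_10_12:
  assumes "h 8 12" "h 11 12" "v 10 12"
  shows False
proof -
  \<comment> \<open>Finitely many instances of the axioms, namely those that only speak about a 15 by 18 box
    around the gap, are already propositionally unsatisfiable.\<close>
  have "list_all (\<lambda>x. list_all (\<lambda>y.
      (h x y \<or> h (x - 1) y \<or> v x y \<or> v x (y - 1)) \<and>
      (\<not> h x y \<or> \<not> h (x - 1) y) \<and> (\<not> v x y \<or> \<not> v x (y - 1)) \<and>
      (\<not> h x y \<or> \<not> v x y) \<and> (\<not> h x y \<or> \<not> v x (y - 1)) \<and>
      (\<not> h (x - 1) y \<or> \<not> v x y) \<and> (\<not> h (x - 1) y \<or> \<not> v x (y - 1)))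
      [4..19]) [4..16]"
    unfolding list_all_iff using cover disjoint by blast
  note cells = this[simplified]
  \<comment> \<open>One clause per conjunct of \<open>h_run\<close> and \<open>h_run'\<close>. The
    ranges keep all columns within 3 to 16, those of \<open>h\<close> in \<open>cells\<close>; for
    \<open>v_runs\<close> the rows stay within 3 to 19.\<close>
  have "list_all (\<lambda>y.
      list_all (\<lambda>x. h x y \<longrightarrow> h (x - 3) y \<or> h (x + 3) y) [6..13] \<and>
      list_all (\<lambda>x. h x y \<longrightarrow> h (x - 3) y \<or> h (x + 6) y) [6..10] \<and>
      list_all (\<lambda>x. h x y \<longrightarrow> h (x - 3) y \<or> h (x + 9) y) [6..7] \<and>
      list_all (\<lambda>x. h x y \<longrightarrow> h (x + 3) y \<or> h (x - 6) y) [9..13] \<and>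
      list_all (\<lambda>x. h x y \<longrightarrow> h (x + 3) y \<or> h (x - 9) y) [12..13]) [4..19]"
    unfolding list_all_iff using h_run h_run' by blast
  note h_runs = this[simplified]
  have "list_all (\<lambda>x.
      list_all (\<lambda>y. v x y \<longrightarrow> v x (y - 3) \<or> v x (y + 3)) [6..16] \<and>
      list_all (\<lambda>y. v x y \<longrightarrow> v x (y - 3) \<or> v x (y + 6)) [6..13] \<and>
      list_all (\<lambda>y. v x y \<longrightarrow> v x (y - 3) \<or> v x (y + 9)) [6..10] \<and>
      list_all (\<lambda>y. v x y \<longrightarrow> v x (y + 3) \<or> v x (y - 6)) [9..16] \<and>
      list_all (\<lambda>y. v x y \<longrightarrow> v x (y + 3) \<or> v x (y - 9)) [12..16]) [4..16]"
    unfolding list_all_iff using v_run v_run' by blast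
  note v_runs = this[simplified]
  note clauses = assms cells h_runs v_runs
  \<comment> \<open>The refutation is split: the run of \<open>v 10 12\<close> first has to continue
    below and above.\<close>
  have "v 10 9" using clauses by sat
  moreover have "v 10 15" using clauses \<open>v 10 9\<close> by sat
  ultimately show False using clauses by sat
qed

lemma no_upward_gap: "\<not> (h x y \<and> h (x + 3) y \<and> v (x + 2) y)"
  using bar_tiling.no_upward_gap_at_10_12[OF translated[of "x - 8" "y - 12"]]
  by (auto simp: algebra_simps)

text \<open>A horizontal domino on the middle cell would overlap one of the two given ones, so a
  vertical domino covers it; if it points downwards, \<open>reflected\<close> turns it
  upwards.\<close>

lemma no_gap: "\<not> (h x y \<and> h (x + 3) y)"
proof
  assume gap: "h x y \<and> h (x + 3) y"
  then have "v (x + 2) y \<or> v (x + 2) (y - 1)"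
    using cover[of "x + 2" y] disjoint(1)[of "x + 1" y] disjoint(1)[of "x + 3" y]
    by (auto simp: algebra_simps)
  then show False
    using gap no_upward_gap[of x y]
      bar_tiling.no_upward_gap[OF reflected, of x "- y"] by auto
qed

lemma no_horizontal: "\<not> h x y"
  using h_run[of x y] no_gap[of x y] no_gap[of "x - 3" y] by auto

lemma inconsistent: False
  using cover no_horizontal bar_tiling.no_horizontal[OF transposed] by blast

end

section \<open>From a tiling of the torus to dominoes in the plane\<close>

lemma reduce_add_eq:
  assumes "reduce p q (x, y) = reduce p q (x', y')"
  shows "reduce p q (x + s, y + t) = reduce p q (x' + s, y' + t)"
  using assms by (auto simp: reduce_def intro: mod_add_cong)

lemma no_torus_tiling:
  assumes "p > 0" "q > 0"
  shows "\<not> torus_tiling p q D4 C"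
proof
  assume "torus_tiling p q D4 C"
  then have C: "C \<subseteq> torus_copies p q D4" "disjoint C" "\<Union> C = torus p q"
    by (auto simp: torus_tiling_def)
  have "\<forall>c\<in>C. \<exists>w a b. (\<forall>t. t \<in> c \<longleftrightarrow> (\<exists>d\<in>offsets. t = reduce p q (bar w a b d))) \<and>
      inj_on (\<lambda>d. reduce p q (bar w a b d)) offsets"
  proof
    fix c assume "c \<in> C"
    then obtain w a b where c: "c = reduce p q ` bar w a b ` offsets"
        "inj_on (\<lambda>d. reduce p q (bar w a b d)) offsets"
      using C(1) torus_copies_D4[of c p q] by (metis subsetD)
    show "\<exists>w a b. (\<forall>t. t \<in> c \<longleftrightarrow> (\<exists>d\<in>offsets. t = reduce p q (bar w a b d))) \<and>
        inj_on (\<lambda>d. reduce p q (bar w a b d)) offsets"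
      by (rule exI[of _ w], rule exI[of _ a], rule exI[of _ b]) (use c(2) in \<open>auto simp: c(1)\<close>)
  qed
  \<comment> \<open>An image on the torus may come from several placements (for instance when \<open>p = 12\<close>),
    so one placement is fixed for each copy.\<close>
  then obtain W A B where
    mem: "\<And>c t. c \<in> C \<Longrightarrow> t \<in> c \<longleftrightarrow> (\<exists>d\<in>offsets. t = reduce p q (bar (W c) (A c) (B c) d))"
    and inj: "\<And>c. c \<in> C \<Longrightarrow> inj_on (\<lambda>d. reduce p q (bar (W c) (A c) (B c) d)) offsets"
    by metis
  \<comment> \<open>The periodic lift to the plane: a cell is labelled by the orientation and offset
    at which a copy meets its residue class. Covering gives \<open>ex\<close>; disjointness and
    injectivity give \<open>unique\<close>.\<close>
  define L where "L x y w d \<longleftrightarrow> (\<exists>c\<in>C. W c = w \<and> d \<in> offsets \<and>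
      reduce p q (x, y) = reduce p q (bar w (A c) (B c) d))" for x y w d
  have ex: "\<exists>w. \<exists>d\<in>offsets. L x y w d" for x y
  proof -
    have "reduce p q (x, y) \<in> torus p q"
      using assms by (simp add: reduce_def torus_def)
    then obtain c where c: "c \<in> C" "reduce p q (x, y) \<in> c"
      unfolding C(3)[symmetric] by blast
    then show ?thesis
      unfolding L_def using mem[OF c(1), of "reduce p q (x, y)"] by blast
  qed
  have unique: "w = w' \<and> d = d'" if L: "L x y w d" "L x y w' d'" for x y w d w' d'
  proof -
    from L obtain c c' where c: "c \<in> C" "W c = w" "d \<in> offsets"
        "reduce p q (x, y) = reduce p q (bar w (A c) (B c) d)"
      and c': "c' \<in> C" "W c' = w'" "d' \<in> offsets"
        "reduce p q (x, y) = reduce p q (bar w' (A c') (B c') d')"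
      unfolding L_def by blast
    then have "reduce p q (x, y) \<in> c \<inter> c'"
      using mem[OF c(1), of "reduce p q (x, y)"] mem[OF c'(1), of "reduce p q (x, y)"] by blast
    then have "c = c'"
      using C(2) c(1) c'(1) by (auto simp: disjoint_def)
    then show ?thesis
      using c c' inj by (auto dest: inj_onD)
  qed
  have right: "L (x + s) y False (d + s)" if "L x y False d" "d + s \<in> offsets" for x y d s
    using that reduce_add_eq[of p q x y _ _ s 0] unfolding L_def by (fastforce simp: bar_def add.assoc)
  have up: "L x (y + s) True (d + s)" if "L x y True d" "d + s \<in> offsets" for x y d s
    using that reduce_add_eq[of p q x y _ _ 0 s] unfolding L_def by (fastforce simp: bar_def add.assoc)
  have left1: "L (x - 1) y False d \<longleftrightarrow> L x y False (d + 1)" if "d \<in> {0, 3, 6, 9}" for x y d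
    using right[of "x - 1" y d 1] right[of x y "d + 1" "- 1"] that by (auto simp: offsets_def)
  have down1: "L x (y - 1) True d \<longleftrightarrow> L x y True (d + 1)" if "d \<in> {0, 3, 6, 9}" for x y d
    using up[of x "y - 1" d 1] up[of x y "d + 1" "- 1"] that by (auto simp: offsets_def)
  \<comment> \<open>The dominoes of a bar start at offsets 0, 3, 6, 9 and end at 1, 4, 7, 10. With
    \<open>h_left\<close> and \<open>v_below\<close>, covering and disjointness become statements
    about the label of a single cell.\<close>
  define h where "h x y \<longleftrightarrow> (\<exists>d\<in>{0, 3, 6, 9}. L x y False d)" for x y
  define v where "v x y \<longleftrightarrow> (\<exists>d\<in>{0, 3, 6, 9}. L x y True d)" for x y
  have h_left: "h (x - 1) y \<longleftrightarrow> (\<exists>d\<in>{1, 4, 7, 10}. L x y False d)" for x y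
    by (simp add: h_def left1)
  have v_below: "v x (y - 1) \<longleftrightarrow> (\<exists>d\<in>{1, 4, 7, 10}. L x y True d)" for x y
    by (simp add: v_def down1)
  have "bar_tiling h v"
  proof unfold_locales
    fix x y
    show "h x y \<or> h (x - 1) y \<or> v x y \<or> v x (y - 1)"
    proof -
      obtain w d where "L x y w d" "d \<in> offsets" using ex by blast
      then show ?thesis
        unfolding h_left v_below unfolding h_def v_def by (cases w) (auto simp: offsets_def)
    qed
    \<comment> \<open>Offset 0 has the other three dominoes of the bar to its right; from 3, 6 or 9,
      going back by 3 stays in the bar.\<close>
    show "h (x - 3) y \<or> h (x + 3) y \<and> h (x + 6) y \<and> h (x + 9) y" if h: "h x y"
    proof (cases "L x y False 0")
      case True
      then show ?thesis
        using right[of x y 0 3] right[of x y 0 6] right[of x y 0 9]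
        by (simp add: h_def offsets_def)
    next
      case False
      then obtain d where "d \<in> {3, 6, 9}" "L x y False d" using h by (auto simp: h_def)
      then show ?thesis
        using right[of x y d "- 3"] by (auto simp: h_def offsets_def)
    qed
    show "v x (y - 3) \<or> v x (y + 3) \<and> v x (y + 6) \<and> v x (y + 9)" if v: "v x y"
    proof (cases "L x y True 0")
      case True
      then show ?thesis
        using up[of x y 0 3] up[of x y 0 6] up[of x y 0 9]
        by (simp add: v_def offsets_def)
    next
      case False
      then obtain d where "d \<in> {3, 6, 9}" "L x y True d" using v by (auto simp: v_def)
      then show ?thesis
        using up[of x y d "- 3"] by (auto simp: v_def offsets_def)
    qed
  qed (unfold h_left v_below, unfold h_def v_def, auto dest: unique)
  then show False by (rule bar_tiling.inconsistent)
qed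

section \<open>The signed tiling of the 24 by 12 torus\<close>

text \<open>The horizontal copies of one row cover the columns 10, 13, 16, 19 with multiplicity 3 and the
  others with multiplicity 1; the last part of the list corrects the former.\<close>

definition placements :: "(int \<times> bool \<times> int \<times> int) list" where
  "placements =
    [(e, False, a, b). b \<leftarrow> [0, 3, 6, 9],
      (e, a) \<leftarrow> [(1, 1), (1, 3), (-1, 4), (1, 5), (-1, 6), (1, 7), (-1, 8), (1, 9),
                 (1, 10), (-1, 11), (1, 12), (1, 14)]] @
    [(1, True, a, 1). a \<leftarrow> [0..23]] @
    [(e, True, a, b). a \<leftarrow> [10, 13, 16, 19], (e, b) \<leftarrow> [(-1, 0), (1, 1), (-1, 2)]]"

text \<open>An executable form of membership in a wrapped bar. Modulo 12 the only residue above 10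
  is 11, which the condition modulo 3 already excludes.\<close>

definition covers :: "bool \<Rightarrow> int \<Rightarrow> int \<Rightarrow> int \<Rightarrow> int \<Rightarrow> bool" where
  "covers w a b x y \<longleftrightarrow>
    (if w then (x - a) mod 24 = 0 \<and> (y - b) mod 12 mod 3 \<noteq> 2
     else (y - b) mod 12 = 0 \<and> (x - a) mod 24 \<le> 10 \<and> (x - a) mod 24 mod 3 \<noteq> 2)"

text \<open>The bars \<open>(1, True, a, 1)\<close> cover the row classes 1 and 2 modulo 3 once. The
  signed triple in columns 10, 13, 16, 19 adds -2 on class 0 and cancels on the others, so 3 becomes
  1.\<close>

lemma sum_covers:
  "list_all (\<lambda>x. list_all (\<lambda>y.
     (\<Sum>(e, w, a, b) \<leftarrow> placements. if covers w a b x y then e else 0) = 1) [0..11]) [0..23]"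
  by code_simp

lemma mod_eq_offset_iff:
  fixes x a d m :: int
  assumes "0 \<le> x" "x < m" "0 \<le> d" "d < m"
  shows "x = (a + d) mod m \<longleftrightarrow> (x - a) mod m = d"
proof -
  have "x = (a + d) mod m \<longleftrightarrow> x mod m = (a + d) mod m" using assms by simp
  also have "\<dots> \<longleftrightarrow> (x - a) mod m = d mod m"
    by (simp add: mod_eq_dvd_iff algebra_simps)
  finally show ?thesis using assms by simp
qed

lemma mem_reduced_bar:
  assumes "(x, y) \<in> torus 24 12"
  shows "(x, y) \<in> reduce 24 12 ` bar w a b ` offsets \<longleftrightarrow> covers w a b x y"
proof -
  have xy: "0 \<le> x" "x < 24" "0 \<le> y" "y < 12"
    using assms by (auto simp: torus_def)
  have off: "0 \<le> d \<and> d < 12 \<and> d < 24" if "d \<in> offsets" for d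
    using that by (auto simp: offsets_def)
  show ?thesis
  proof (cases w)
    case True
    have "(x, y) \<in> reduce 24 12 ` bar w a b ` offsets \<longleftrightarrow>
        x = (a + 0) mod 24 \<and> (\<exists>d\<in>offsets. y = (b + d) mod 12)"
      by (auto simp: True reduce_def bar_def)
    also have "\<dots> \<longleftrightarrow> (x - a) mod 24 = 0 \<and> (\<exists>d\<in>offsets. (y - b) mod 12 = d)"
      using xy off mod_eq_offset_iff[of x 24 0 a] mod_eq_offset_iff[of y 12 _ b] by auto
    also have "(\<exists>d\<in>offsets. (y - b) mod 12 = d) \<longleftrightarrow> (y - b) mod 12 mod 3 \<noteq> 2"
    proof -
      have "(y - b) mod 12 \<le> 10 \<or> (y - b) mod 12 = 11" by presburger
      then show ?thesis by (auto simp: offsets_alt)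
    qed
    finally show ?thesis by (simp add: covers_def True)
  next
    case False
    have "(x, y) \<in> reduce 24 12 ` bar w a b ` offsets \<longleftrightarrow>
        y = (b + 0) mod 12 \<and> (\<exists>d\<in>offsets. x = (a + d) mod 24)"
      by (auto simp: False reduce_def bar_def)
    also have "\<dots> \<longleftrightarrow> (y - b) mod 12 = 0 \<and> (\<exists>d\<in>offsets. (x - a) mod 24 = d)"
      using xy off mod_eq_offset_iff[of y 12 0 b] mod_eq_offset_iff[of x 24 _ a] by auto
    finally show ?thesis by (simp add: covers_def False offsets_alt)
  qed
qed

lemma inj_on_reduced_bar: "inj_on (\<lambda>d. reduce 24 12 (bar w a b d)) offsets"
proof (rule inj_onI)
  fix d d' assume d: "d \<in> offsets" "d' \<in> offsets"
    and "reduce 24 12 (bar w a b d) = reduce 24 12 (bar w a b d')"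
  then have "(a + d) mod 24 = (a + d') mod 24 \<or> (b + d) mod 12 = (b + d') mod 12"
    by (auto simp: reduce_def bar_def split: if_splits)
  \<comment> \<open>As 12 divides 24, both orientations give this; offsets differ by at most
    10.\<close>
  then have "12 dvd d - d'"
    by (auto simp: mod_eq_dvd_iff intro: dvd_trans[of 12 24])
  then show "d = d'"
    using d unfolding offsets_alt by auto presburger
qed

lemma reduced_bar_in_torus_copies: "reduce 24 12 ` bar w a b ` offsets \<in> torus_copies 24 12 D4"
  unfolding torus_copies_D4
  by (rule exI[of _ w], rule exI[of _ a], rule exI[of _ b]) (simp add: inj_on_reduced_bar)

lemma signed_torus_tiling_D4:
  "signed_torus_tiling 24 12 D4
     (map (\<lambda>(e, w, a, b). (e, reduce 24 12 ` bar w a b ` offsets)) placements)"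
  unfolding signed_torus_tiling_def
proof (intro conjI ballI)
  fix t assume t: "t \<in> torus 24 12"
  obtain x y where xy: "t = (x, y)" by fastforce
  have "(\<Sum>(e, w, a, b) \<leftarrow> placements. if covers w a b x y then e else 0) = 1"
    using sum_covers t unfolding list_all_iff xy by (auto simp: torus_def)
  moreover have "e * indicator (reduce 24 12 ` bar w a b ` offsets) t = (if covers w a b x y then e else 0)"
    for e :: int and w a b
    using mem_reduced_bar t unfolding xy indicator_def by simp
  ultimately show "(\<Sum>(e, c) \<leftarrow> map (\<lambda>(e, w, a, b). (e, reduce 24 12 ` bar w a b ` offsets)) placements.
      e * indicator c t) = 1"
    by (simp add: comp_def case_prod_unfold)
next
  fix ec assume "ec \<in> set (map (\<lambda>(e, w, a, b). (e, reduce 24 12 ` bar w a b ` offsets)) placements)"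
  then obtain e w a b where ec: "ec = (e, reduce 24 12 ` bar w a b ` offsets)"
      and "(e, w, a, b) \<in> set placements"
    by auto
  then have "e \<in> {1, -1}"
    by (auto simp: placements_def)
  then show "case ec of (e, c) \<Rightarrow> e \<in> {1, -1} \<and> c \<in> torus_copies 24 12 D4"
    using reduced_bar_in_torus_copies unfolding ec by simp
qed

theorem theorem2:
  shows "(\<forall>p q. p > 0 \<longrightarrow> q > 0 \<longrightarrow> \<not> (\<exists>C. torus_tiling p q D4 C)) \<and>
         (\<exists>cs. signed_torus_tiling 24 12 D4 cs)"
  using no_torus_tiling signed_torus_tiling_D4 by blast

end
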